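(* For every integer $m\ge 5$, $$\mathcal{G}(\mathcal{P}_{0,1}(m,1))=\mathcal{G}(\mathcal{P}_{1,0}(m,1)) = \mathcal{G}(\mathcal{P}_{0,1}(m,2))=\mathcal{G}(\mathcal{P}_{1,0}(m,2)).$$
   Context: Toggle: Let $G$ be a finite simple graph, with $N[v]$ the closed neighborhood of $v$. A position $\{G,V_0\}$ consists of $G$ and a set $V_0\subseteq V(G)$ of vertices of weight $0$; all other vertices have weight $1$. Let $\sigma(v)$ be the sum of the weights of the vertices in $N[v]$. A legal move consists of choosing a vertex $v$ of weight $1$ and switching the weight ($0\leftrightarrow 1$) of every vertex of $N[v]$; it is allowed only if $\sigma(v)$ after the switch is strictly smaller than $\sigma(v)$ before it. Two players alternate legal moves; a player with no legal move loses. Nimbers: $\mathcal{G}(\mathcal{S})=\mathrm{mex}\{\mathcal{G}(\mathcal{S}') : \mathcal{S}' \text{ reachable from } \mathcal{S} \text{ by one legal move}\}$, where $\mathrm{mex}(T)$ is the least nonnegative integer not in the finite set $T$ (so $\mathrm{mex}(\emptyset)=0$). The generalized Petersen graph $P(m,k)$ ($1\le k\le\lfloor\frac{m-1}{2}\rfloor$) has inner vertices $v_{0,1},\dots,v_{0,m}$ and outer vertices $v_{1,1},\dots,v_{1,m}$ (second indices modulo $m$), with edges $v_{1,i}v_{1,i+1}$, $v_{0,i}v_{0,i+k}$ and $v_{0,i}v_{1,i}$ for all $i$. Positions on $P(m,k)$: $\mathcal{P}_{0,1}(m,k)$ has all inner vertices of weight $0$ and all outer vertices of weight $1$; $\mathcal{P}_{1,0}(m,k)$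 has all inner vertices of weight $1$ and all outer vertices of weight $0$. *)

theory Defs
  imports Main
begin

section \<open>Finite simple graphs\<close>

record 'a graph =
  verts :: "'a set"
  edges :: "'a set set"

definition finite_simple_graph :: "'a graph \<Rightarrow> bool" where
  "finite_simple_graph G \<longleftrightarrow>
     finite (verts G) \<and> (\<forall>e \<in> edges G. e \<subseteq> verts G \<and> card e = 2)"

definition closed_nbhd :: "'a graph \<Rightarrow> 'a \<Rightarrow> 'a set" where
  "closed_nbhd G v = insert v {u. {u, v} \<in> edges G}"


section \<open>The game of Toggle\<close>

text \<open>A position \<open>(G, V0)\<close> consists of a graph \<open>G\<close> and the set \<open>V0 \<subseteq> verts G\<close> of vertices
  of weight 0.\<close>

type_synonym 'a position = "'a graph \<times> 'a set"

definition weight :: "'a set \<Rightarrow> 'a \<Rightarrow> nat" where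
  "weight V0 v = (if v \<in> V0 then 0 else 1)"

definition nbhd_weight :: "'a graph \<Rightarrow> 'a set \<Rightarrow> 'a \<Rightarrow> nat" where
  "nbhd_weight G V0 v = (\<Sum>u \<in> closed_nbhd G v. weight V0 u)"

text \<open>Switching all weights in \<open>N[v]\<close> replaces \<open>V0\<close> by its symmetric difference with \<open>N[v]\<close>.\<close>

definition switch :: "'a graph \<Rightarrow> 'a \<Rightarrow> 'a set \<Rightarrow> 'a set" where
  "switch G v V0 = (V0 - closed_nbhd G v) \<union> (closed_nbhd G v - V0)"

definition legal_move :: "'a graph \<Rightarrow> 'a set \<Rightarrow> 'a set \<Rightarrow> bool" where
  "legal_move G V0 V1 \<longleftrightarrow>
     (\<exists>v \<in> verts G. weight V0 v = 1 \<and> V1 = switch G v V0 \<and>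
        nbhd_weight G V1 v < nbhd_weight G V0 v)"


section \<open>Nimbers\<close>

definition mex :: "nat set \<Rightarrow> nat" where
  "mex T = (LEAST n. n \<notin> T)"

lemma closed_nbhd_subset:
  assumes "finite_simple_graph G" "v \<in> verts G"
  shows "closed_nbhd G v \<subseteq> verts G"
  using assms unfolding finite_simple_graph_def closed_nbhd_def by auto

lemma weight_switch_outside:
  "u \<notin> closed_nbhd G v \<Longrightarrow> weight (switch G v V0) u = weight V0 u"
  by (simp add: weight_def switch_def)

text \<open>A legal move at \<open>v\<close> changes weights only inside \<open>N[v]\<close>, so it decreases the total
  weight.\<close>

lemma legal_move_decreases:
  assumes G: "finite_simple_graph G" and mv: "legal_move G V0 V1"
  shows "(\<Sum>u \<in> verts G. weight V1 u) < (\<Sum>u \<in> verts G. weight V0 u)"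
proof -
  from mv obtain v where v: "v \<in> verts G" "V1 = switch G v V0"
    "nbhd_weight G V1 v < nbhd_weight G V0 v"
    unfolding legal_move_def by blast
  let ?N = "closed_nbhd G v"
  have fin: "finite (verts G)" using G by (simp add: finite_simple_graph_def)
  have sub: "?N \<subseteq> verts G" using closed_nbhd_subset[OF G v(1)] .
  have split: "(\<Sum>u \<in> verts G. weight W u)
      = (\<Sum>u \<in> verts G - ?N. weight W u) + nbhd_weight G W v" for W
    unfolding nbhd_weight_def using sum.subset_diff[OF sub fin] .
  have "(\<Sum>u \<in> verts G - ?N. weight V1 u) = (\<Sum>u \<in> verts G - ?N. weight V0 u)"
    by (rule sum.cong) (auto simp: v(2) weight_switch_outside)
  with v(3) show ?thesis by (simp add: split)
qed

text \<open>The value 0 for structures that are not finite simple graphs is a dummy that makes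
  the recursion well-founded.\<close>

function nimber :: "'a position \<Rightarrow> nat" where
  "nimber (G, V0) =
     (if finite_simple_graph G
      then mex ((\<lambda>V1. nimber (G, V1)) ` {V1. legal_move G V0 V1}) else 0)"
  by pat_completeness auto
termination
  by (relation "measure (\<lambda>(G, V0). \<Sum>u \<in> verts G. weight V0 u)")
     (auto simp: legal_move_decreases)

declare nimber.simps [simp del]


section \<open>Generalized Petersen graphs\<close>

text \<open>The vertex \<open>(r, i)\<close> is $v_{r,i}$: inner for \<open>r = 0\<close>, outer for \<open>r = 1\<close>. Second indices
  are represented by the residues \<open>0, \<dots>, m - 1\<close>, with \<open>0\<close> in the role of \<open>m\<close>.\<close>

definition gen_petersen :: "nat \<Rightarrow> nat \<Rightarrow> (nat \<times> nat) graph" where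
  "gen_petersen m k =
     \<lparr>verts = {0, 1} \<times> {..<m},
      edges = {{(1, i), (1, (i + 1) mod m)} | i. i < m}
            \<union> {{(0, i), (0, (i + k) mod m)} | i. i < m}
            \<union> {{(0, i), (1, i)} | i. i < m}\<rparr>"

lemma add_mod_neq:
  fixes i k m :: nat
  assumes "i < m" "1 \<le> k" "k < m"
  shows "i \<noteq> (i + k) mod m"
proof (cases "i + k < m")
  case False
  then have "(i + k) mod m = i + k - m" using assms by (simp add: mod_if)
  then show ?thesis using assms False by linarith
qed (use assms in simp)

lemma finite_simple_graph_gen_petersen:
  assumes "1 \<le> k" "k \<le> (m - 1) div 2"
  shows "finite_simple_graph (gen_petersen m k)"
proof -
  have km: "k < m" "1 < m" using assms by linarith+
  have "i \<noteq> (i + k) mod m" "i \<noteq> Suc i mod m" if "i < m" for i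
    using add_mod_neq[OF that, of k] add_mod_neq[OF that, of 1] km assms by auto
  then show ?thesis
    using km unfolding finite_simple_graph_def gen_petersen_def
    by (auto simp: card_insert_if)
qed

definition P01 :: "nat \<Rightarrow> nat \<Rightarrow> (nat \<times> nat) position" where
  "P01 m k = (gen_petersen m k, {0} \<times> {..<m})"

definition P10 :: "nat \<Rightarrow> nat \<Rightarrow> (nat \<times> nat) position" where
  "P10 m k = (gen_petersen m k, {1} \<times> {..<m})"

end

theory Submission
  imports Defs
begin

text \<open>Call the row of weight 1 the played row, and let \<open>d\<close> be its step, so that playing \<open>i\<close>
  clears the arc \<open>{i - d, i, i + d}\<close>. The graph is cubic, so a move needs at least two neighbours
  of weight 1; this forces the chosen arcs to be pairwise disjoint, and the vertices
  of the other row that become 1 are never playable. Toggle is thus the game of packing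
  disjoint arcs. The step is 1 in three of the positions and 2 in \<open>P10 m 2\<close>. For odd \<open>m\<close>, doubling
  modulo \<open>m\<close> carries one packing game to the other. For even \<open>m\<close> both have nimber 0: the second player
  answers with a fixed point free symmetry that moves every arc off itself, namely the antipodal map
  for step 1 and the exchange of the two residue classes modulo 2 for step 2.\<close>

section \<open>Comparing nimbers\<close>

text \<open>The two conditions match the options of \<open>X\<close> and \<open>Y\<close> in both
  directions, so the same set of nimbers enters \<open>mex\<close>. The induction runs on the total
  weight in \<open>G\<close>, which every move lowers.\<close>

lemma nimber_bisim:
  assumes G: "finite_simple_graph G" and H: "finite_simple_graph H"
    and "R X Y"
    and forward: "\<And>X Y X'. R X Y \<Longrightarrow> legal_move G X X' \<Longrightarrow> \<exists>Y'. legal_move H Y Y' \<and> R X' Y'"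
    and backward: "\<And>X Y Y'. R X Y \<Longrightarrow> legal_move H Y Y' \<Longrightarrow> \<exists>X'. legal_move G X X' \<and> R X' Y'"
  shows "nimber (G, X) = nimber (H, Y)"
  using \<open>R X Y\<close>
proof (induction "\<Sum>u \<in> verts G. weight X u" arbitrary: X Y rule: less_induct)
  case less
  have eq: "nimber (G, X') = nimber (H, Y')" if "legal_move G X X'" "R X' Y'" for X' Y'
    using less.hyps that legal_move_decreases[OF G] by blast
  have "(\<lambda>X'. nimber (G, X')) ` {X'. legal_move G X X'} =
        (\<lambda>Y'. nimber (H, Y')) ` {Y'. legal_move H Y Y'}"
    using forward[OF less.prems] backward[OF less.prems] eq by (fastforce simp: image_iff)
  then show ?case
    using G H by (simp only: nimber.simps[of G X] nimber.simps[of H Y] if_True)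
qed

text \<open>Finiteness leaves a number outside \<open>T\<close>; for \<open>T = UNIV\<close> the
  \<open>LEAST\<close> in \<open>mex\<close> would be unspecified.\<close>

lemma mex_eq_0_iff: "mex T = 0 \<longleftrightarrow> 0 \<notin> T" if "finite T"
proof
  assume "mex T = 0"
  moreover have "mex T \<notin> T"
    unfolding mex_def by (rule LeastI_ex) (use that ex_new_if_finite infinite_UNIV_nat in blast)
  ultimately show "0 \<notin> T" by simp
qed (simp add: mex_def)

lemma finite_legal_moves:
  assumes "finite_simple_graph G"
  shows "finite {Y. legal_move G X Y}"
proof (rule finite_subset)
  show "{Y. legal_move G X Y} \<subseteq> (\<lambda>v. switch G v X) ` verts G"
    unfolding legal_move_def by blast
qed (use assms in \<open>simp add: finite_simple_graph_def\<close>)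

lemma nimber_eq_0_iff:
  assumes "finite_simple_graph G"
  shows "nimber (G, X) = 0 \<longleftrightarrow> (\<forall>Y. legal_move G X Y \<longrightarrow> nimber (G, Y) \<noteq> 0)"
proof -
  have "nimber (G, X) = mex ((\<lambda>Y. nimber (G, Y)) ` {Y. legal_move G X Y})"
    using assms by (simp only: nimber.simps[of G X] if_True)
  then show ?thesis
    using mex_eq_0_iff[OF finite_imageI[OF finite_legal_moves[OF assms]]] by auto
qed

text \<open>\<open>P\<close> is the invariant that the second player restores. Every option
  \<open>Y\<close> has an option \<open>Z\<close> of nimber 0 by induction, so the nimber of
  \<open>Y\<close> is positive.\<close>

lemma nimber_eq_0_strategy:
  assumes G: "finite_simple_graph G"
    and "P X"
    and answer: "\<And>X Y. P X \<Longrightarrow> legal_move G X Y \<Longrightarrow> \<exists>Z. legal_move G Y Z \<and> P Z"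
  shows "nimber (G, X) = 0"
  using \<open>P X\<close>
proof (induction "\<Sum>u \<in> verts G. weight X u" arbitrary: X rule: less_induct)
  case less
  have "nimber (G, Y) \<noteq> 0" if Y: "legal_move G X Y" for Y
  proof -
    obtain Z where Z: "legal_move G Y Z" "P Z"
      using answer[OF less.prems Y] by blast
    with less.hyps[of Z] legal_move_decreases[OF G Y] legal_move_decreases[OF G Z(1)]
    have "nimber (G, Z) = 0" by simp
    with Z(1) show ?thesis
      by (auto simp: nimber_eq_0_iff[OF G, of Y])
  qed
  then show ?case
    by (simp add: nimber_eq_0_iff[OF G, of X])
qed

section \<open>Packings of arcs\<close>

text \<open>The part of a closed neighborhood in its own row; \<open>m - d\<close> stands for
  \<open>-d\<close> modulo \<open>m\<close>.\<close>

definition arc :: "nat \<Rightarrow> nat \<Rightarrow> nat \<Rightarrow> nat set" where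
  "arc m d i = {i, (i + d) mod m, (i + (m - d)) mod m}"

text \<open>\<open>S\<close> holds the centres of the moves played so far, as reduced
  residues.\<close>

definition packing :: "nat \<Rightarrow> nat \<Rightarrow> nat set \<Rightarrow> bool" where
  "packing m d S \<longleftrightarrow> S \<subseteq> {..<m} \<and> (\<forall>i \<in> S. \<forall>j \<in> S. i \<noteq> j \<longrightarrow> arc m d i \<inter> arc m d j = {})"

section \<open>Arithmetic of residues and arcs\<close>

lemma add_mod_if:
  fixes i k m :: nat
  assumes "i < m" "k \<le> m"
  shows "(i + k) mod m = (if i + k < m then i + k else i + k - m)"
proof (cases "i + k < m")
  case False
  then have "(i + k) mod m = (i + k - m) mod m" by (simp add: le_mod_geq)
  also have "\<dots> = i + k - m" using assms False by (intro mod_less) linarith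
  finally show ?thesis using False by simp
qed simp

lemma sub_mod_if:
  fixes i k m :: nat
  assumes "i < m" "k \<le> m"
  shows "(i + (m - k)) mod m = (if k \<le> i then i - k else i + m - k)"
  unfolding add_mod_if[OF assms(1) diff_le_self] using assms by (cases "k \<le> i") auto

lemma arc_if:
  assumes "i < m" "d \<le> m"
  shows "arc m d i =
    {i, if i + d < m then i + d else i + d - m, if d \<le> i then i - d else i + m - d}"
  unfolding arc_def add_mod_if[OF assms] sub_mod_if[OF assms] ..

lemma packing_empty: "packing m d {}"
  by (simp add: packing_def)

lemma self_in_arc: "i \<in> arc m d i"
  by (simp add: arc_def)

lemma finite_arc: "finite (arc m d i)"
  by (simp add: arc_def)

lemma arc_subset: "i < m \<Longrightarrow> arc m d i \<subseteq> {..<m}"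
  by (auto simp: arc_def)

lemma card_arc:
  assumes "i < m" "0 < d" "2 * d < m"
  shows "card (arc m d i) = 3"
  using assms unfolding card_3_iff
  by (intro exI[of _ i] exI[of _ "if i + d < m then i + d else i + d - m"]
      exI[of _ "if d \<le> i then i - d else i + m - d"]) (auto simp: arc_if)

text \<open>\<open>j \<notin> S\<close> matters: otherwise the left side holds trivially, while on
  the right the arc of \<open>j\<close> meets itself.\<close>

lemma packing_insert:
  assumes "packing m d S" "j < m" "j \<notin> S"
  shows "packing m d (insert j S) \<longleftrightarrow> arc m d j \<inter> \<Union> (arc m d ` S) = {}"
proof -
  have "S \<subseteq> {..<m}" using assms(1) by (simp add: packing_def)
  then have "packing m d (insert j S) \<longleftrightarrow> (\<forall>s \<in> S. arc m d j \<inter> arc m d s = {})"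
    using assms by (auto simp: packing_def Int_commute)
  then show ?thesis by blast
qed

text \<open>The centres \<open>i\<close>, \<open>i + e\<close> and \<open>i - e\<close> are too
  close to be packed together: the arcs of two of them share \<open>i + 1\<close>.\<close>

lemma arc_subset_packing:
  assumes "packing m d S" "arc m e i \<subseteq> S" "m \<ge> 5" "(d, e) \<in> {(1, 1), (1, 2), (2, 1)}"
  shows False
proof -
  define a b where "a = (i + e) mod m" and "b = (i + (m - e)) mod m"
  have S: "i \<in> S" "a \<in> S" "b \<in> S" and "i < m"
    using assms(1,2) by (auto simp: arc_def packing_def a_def b_def)
  have "e \<le> m" using assms(3,4) by auto
  note ab = a_def[unfolded add_mod_if[OF \<open>i < m\<close> \<open>e \<le> m\<close>]]
    b_def[unfolded sub_mod_if[OF \<open>i < m\<close> \<open>e \<le> m\<close>]]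
  have neq: "i \<noteq> a" "a \<noteq> b"
    using \<open>i < m\<close> assms(3,4) by (auto simp: ab split: if_splits)
  have "i + 2 + (m - 1) = i + 1 + m" "i + (m - 1) + 2 = i + 1 + m"
    using assms(3) by simp_all
  then have "(a + (m - 1)) mod m = (i + 1) mod m \<or> e \<noteq> 2" "(b + 2) mod m = (i + 1) mod m \<or> e \<noteq> 1"
    unfolding a_def b_def by (metis mod_add_left_eq mod_add_self2)+
  \<comment> \<open>For \<open>d = 1\<close> the arcs of \<open>i\<close> and \<open>a\<close> meet;
    for \<open>d = 2\<close> those of \<open>a\<close> and \<open>b\<close> do, as
    \<open>i + 1\<close> is then \<open>a\<close> itself and \<open>b + 2\<close>.\<close>
  then have "(i + 1) mod m \<in> arc m d i \<inter> arc m d a \<or> (i + 1) mod m \<in> arc m d a \<inter> arc m d b"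
    using assms(4) by (auto simp: arc_def a_def)
  then have "arc m d i \<inter> arc m d a \<noteq> {} \<or> arc m d a \<inter> arc m d b \<noteq> {}"
    by blast
  with S neq assms(1) show False
    unfolding packing_def by blast
qed

section \<open>Toggle as a packing game\<close>

text \<open>Row \<open>r\<close> starts with weight 1 and has step \<open>d\<close>; row
  \<open>q\<close> starts with weight 0 and has step \<open>e\<close>. The three pairs of steps
  cover all four positions.\<close>

locale two_rows =
  fixes G :: "(nat \<times> nat) graph" and r q m d e :: nat
  assumes simple: "finite_simple_graph G"
    and verts: "verts G = {r, q} \<times> {..<m}"
    and rows: "r \<noteq> q"
    and nbhd_played: "i < m \<Longrightarrow> closed_nbhd G (r, i) = insert (q, i) ({r} \<times> arc m d i)"
    and nbhd_other: "i < m \<Longrightarrow> closed_nbhd G (q, i) = insert (r, i) ({q} \<times> arc m e i)"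
    and m: "m \<ge> 5"
    and steps: "(d, e) \<in> {(1, 1), (1, 2), (2, 1)}"
begin

text \<open>The vertices of weight 0 once the centres in \<open>S\<close> have been played: each
  centre has raised its neighbor in row \<open>q\<close> and cleared its arc in row
  \<open>r\<close>.\<close>

definition state :: "nat set \<Rightarrow> (nat \<times> nat) set" where
  "state S = {q} \<times> ({..<m} - S) \<union> {r} \<times> \<Union> (arc m d ` S)"

lemma nbhd_weight_eq:
  assumes "v \<in> verts G"
  shows "nbhd_weight G V v = card (closed_nbhd G v - V)"
proof -
  have "finite (closed_nbhd G v)"
    using closed_nbhd_subset[OF simple assms] simple
    by (auto simp: finite_simple_graph_def intro: finite_subset)
  then have "nbhd_weight G V v = (\<Sum>u \<in> closed_nbhd G v - V. 1)"
    unfolding nbhd_weight_def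
    by (intro sum.mono_neutral_cong_right) (auto simp: weight_def)
  then show ?thesis by simp
qed

text \<open>Switching exchanges zeros and ones in the closed neighborhood, so the weight after the
  move counts the former zeros.\<close>

lemma legal_move_iff_card:
  "legal_move G V W \<longleftrightarrow>
    (\<exists>v \<in> verts G. v \<notin> V \<and> W = switch G v V \<and>
       card (closed_nbhd G v \<inter> V) < card (closed_nbhd G v - V))"
proof -
  have "closed_nbhd G v - switch G v V = closed_nbhd G v \<inter> V" for v
    by (auto simp: switch_def)
  then show ?thesis
    unfolding legal_move_def by (auto simp: nbhd_weight_eq weight_def)
qed

lemma card_arc_steps: "i < m \<Longrightarrow> card (arc m d i) = 3" "i < m \<Longrightarrow> card (arc m e i) = 3"
  using m steps by (auto intro: card_arc)

text \<open>Weight 1 forces \<open>i \<in> S\<close>, so \<open>(r, i)\<close> was cleared by its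
  own arc, and \<open>arc_subset_packing\<close> yields a second zero in row \<open>q\<close>. Two
  zeros among four vertices rule out a decrease.\<close>

lemma other_not_playable:
  assumes S: "packing m d S" and i: "i < m" "(q, i) \<notin> state S"
  shows "\<not> card (closed_nbhd G (q, i) \<inter> state S) < card (closed_nbhd G (q, i) - state S)"
proof -
  have "i \<in> S" using i by (auto simp: state_def)
  then have U: "i \<in> \<Union> (arc m d ` S)"
    using self_in_arc by blast
  have sub: "arc m e i \<subseteq> {..<m}"
    using i arc_subset by simp
  have "closed_nbhd G (q, i) \<inter> state S = insert (r, i) ({q} \<times> (arc m e i - S))"
    "closed_nbhd G (q, i) - state S = {q} \<times> (arc m e i \<inter> S)"
    using U rows sub by (auto simp: nbhd_other[OF i(1)] state_def)
  moreover have "card (insert (r, i) ({q} \<times> (arc m e i - S))) = Suc (card (arc m e i - S))"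
    using rows finite_arc by (subst card_insert_disjoint) (auto simp: card_cartesian_product)
  moreover have "card (arc m e i - S) + card (arc m e i \<inter> S) = 3"
    using card_arc_steps(2)[OF i(1)] card_Int_Diff[OF finite_arc, of m e i S] by simp
  moreover have "card (arc m e i - S) \<noteq> 0"
    using arc_subset_packing[OF S _ m steps] finite_arc by auto
  ultimately show ?thesis
    by (simp add: card_cartesian_product)
qed

text \<open>If \<open>(r, i)\<close> has weight 1, then \<open>i\<close> is unplayed and
  \<open>(q, i)\<close> has weight 0. With \<open>x\<close> zeros on the arc the rule reads
  \<open>1 + x < 3 - x\<close>, that is, \<open>x = 0\<close>.\<close>

lemma played_playable_iff:
  assumes S: "packing m d S" and i: "i < m"
  shows "(r, i) \<notin> state S \<and>
      card (closed_nbhd G (r, i) \<inter> state S) < card (closed_nbhd G (r, i) - state S) \<longleftrightarrow>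
    i \<notin> S \<and> packing m d (insert i S)"
proof (cases "i \<in> \<Union> (arc m d ` S)")
  case True
  then have "(r, i) \<in> state S" by (auto simp: state_def)
  moreover have "i \<in> S \<or> \<not> packing m d (insert i S)"
    using True packing_insert[OF S i] self_in_arc by blast
  ultimately show ?thesis by blast
next
  case False
  let ?U = "\<Union> (arc m d ` S)"
  have nS: "i \<notin> S" "(r, i) \<notin> state S"
    using False self_in_arc rows by (auto simp: state_def)
  have "closed_nbhd G (r, i) \<inter> state S = insert (q, i) ({r} \<times> (arc m d i \<inter> ?U))"
    "closed_nbhd G (r, i) - state S = {r} \<times> (arc m d i - ?U)"
    using nS rows i by (auto simp: nbhd_played[OF i] state_def)
  moreover have "card (insert (q, i) ({r} \<times> (arc m d i \<inter> ?U))) = Suc (card (arc m d i \<inter> ?U))"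
    using rows finite_arc by (subst card_insert_disjoint) (auto simp: card_cartesian_product)
  moreover have "card (arc m d i \<inter> ?U) + card (arc m d i - ?U) = 3"
    using card_arc_steps(1)[OF i] card_Int_Diff[OF finite_arc, of m d i ?U] by simp
  ultimately have "card (closed_nbhd G (r, i) \<inter> state S) < card (closed_nbhd G (r, i) - state S)
      \<longleftrightarrow> card (arc m d i \<inter> ?U) = 0"
    by (simp add: card_cartesian_product) linarith
  also have "\<dots> \<longleftrightarrow> arc m d i \<inter> ?U = {}"
    using finite_arc by simp
  finally show ?thesis
    using nS packing_insert[OF S i] by simp
qed

text \<open>The new arc is disjoint from the old ones, so the switch undoes no earlier
  change.\<close>

lemma switch_state:
  assumes S: "packing m d S" and i: "i < m" "i \<notin> S" "packing m d (insert i S)"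
  shows "switch G (r, i) (state S) = state (insert i S)"
proof -
  have "arc m d i \<inter> \<Union> (arc m d ` S) = {}"
    using packing_insert[OF S i(1,2)] i(3) by simp
  then show ?thesis
    using rows i(1,2) unfolding switch_def nbhd_played[OF i(1)] state_def by auto
qed

text \<open>The strategy and isomorphism arguments below see the moves only through this
  equivalence.\<close>

lemma legal_move_state_iff:
  assumes S: "packing m d S"
  shows "legal_move G (state S) W \<longleftrightarrow>
    (\<exists>i. i \<notin> S \<and> packing m d (insert i S) \<and> W = state (insert i S))"
proof
  assume "legal_move G (state S) W"
  then obtain v where v: "v \<in> verts G" "v \<notin> state S" "W = switch G v (state S)"
    "card (closed_nbhd G v \<inter> state S) < card (closed_nbhd G v - state S)"
    unfolding legal_move_iff_card by blast
  then obtain i where i: "i < m" "v = (r, i) \<or> v = (q, i)"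
    by (auto simp: verts)
  with v other_not_playable[OF S] have "v = (r, i)" by blast
  with v i have "i \<notin> S" "packing m d (insert i S)" "W = state (insert i S)"
    using played_playable_iff[OF S i(1)] switch_state[OF S i(1)] by auto
  then show "\<exists>i. i \<notin> S \<and> packing m d (insert i S) \<and> W = state (insert i S)"
    by blast
next
  assume "\<exists>i. i \<notin> S \<and> packing m d (insert i S) \<and> W = state (insert i S)"
  then obtain i where i: "i \<notin> S" "packing m d (insert i S)" "W = state (insert i S)"
    by blast
  then have "i < m" by (simp add: packing_def)
  then show "legal_move G (state S) W"
    unfolding legal_move_iff_card
    using i played_playable_iff[OF S \<open>i < m\<close>] switch_state[OF S \<open>i < m\<close>]
    by (intro bexI[of _ "(r, i)"]) (auto simp: verts)
qed

text \<open>The second player answers \<open>i\<close> with \<open>\<phi> i\<close>, which keeps the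
  set of centres closed under the involution \<open>\<phi>\<close>.\<close>

lemma nimber_state_eq_0:
  assumes inv: "\<And>i. i < m \<Longrightarrow> \<phi> (\<phi> i) = i"
    and arc_image: "\<And>i. i < m \<Longrightarrow> arc m d (\<phi> i) = \<phi> ` arc m d i"
    and disj: "\<And>i. i < m \<Longrightarrow> arc m d i \<inter> arc m d (\<phi> i) = {}"
    and range: "\<And>i. i < m \<Longrightarrow> \<phi> i < m"
  shows "nimber (G, state {}) = 0"
proof (rule nimber_eq_0_strategy[OF simple,
      where P = "\<lambda>X. \<exists>S. X = state S \<and> packing m d S \<and> \<phi> ` S \<subseteq> S"])
  show "\<exists>S. state {} = state S \<and> packing m d S \<and> \<phi> ` S \<subseteq> S"
    using packing_empty by blast
next
  fix X Y
  assume "\<exists>S. X = state S \<and> packing m d S \<and> \<phi> ` S \<subseteq> S" and mv: "legal_move G X Y"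
  then obtain S where X: "X = state S" and S: "packing m d S" "\<phi> ` S \<subseteq> S"
    by blast
  obtain i where i: "i \<notin> S" "packing m d (insert i S)" and Y: "Y = state (insert i S)"
    using mv unfolding X legal_move_state_iff[OF S(1)] by blast
  have im: "i < m" and Sm: "S \<subseteq> {..<m}"
    using i(2) by (auto simp: packing_def)
  have "i \<noteq> \<phi> i" using disj[OF im] self_in_arc by fastforce
  \<comment> \<open>Otherwise closure would put \<open>\<phi> (\<phi> i) = i\<close> into
    \<open>S\<close> as well.\<close>
  moreover have "\<phi> i \<notin> S" using inv[OF im] i(1) S(2) by (metis image_subset_iff)
  ultimately have new: "\<phi> i \<notin> insert i S" by simp
  \<comment> \<open>Applying \<open>\<phi>\<close> to a common point would give a common point of
    the arcs of \<open>i\<close> and \<open>\<phi> s\<close>, both of which belong to one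
    packing.\<close>
  have "arc m d (\<phi> i) \<inter> arc m d s = {}" if "s \<in> S" for s
  proof -
    have "s < m" "\<phi> s \<in> S" using that Sm S(2) by auto
    then have "arc m d i \<inter> arc m d (\<phi> s) = {}"
      using i unfolding packing_def by auto
    moreover have "\<phi> x \<in> arc m d i" if "x \<in> arc m d (\<phi> i)" for x
      using that im inv arc_image arc_subset[OF im] by fastforce
    moreover have "\<phi> x \<in> arc m d (\<phi> s)" if "x \<in> arc m d s" for x
      using that arc_image[OF \<open>s < m\<close>] by auto
    ultimately show ?thesis by blast
  qed
  then have "packing m d (insert (\<phi> i) (insert i S))"
    using packing_insert[OF i(2) range[OF im] new] disj[OF im] by auto
  with new have "legal_move G Y (state (insert (\<phi> i) (insert i S)))"
    using legal_move_state_iff[OF i(2)] Y by blast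
  moreover have "\<phi> ` insert (\<phi> i) (insert i S) \<subseteq> insert (\<phi> i) (insert i S)"
    using S(2) inv[OF im] by auto
  ultimately show "\<exists>Z. legal_move G Y Z \<and> (\<exists>S. Z = state S \<and> packing m d S \<and> \<phi> ` S \<subseteq> S)"
    using \<open>packing m d (insert (\<phi> i) (insert i S))\<close> by blast
qed

end

text \<open>A bijection of the residues that carries arcs to arcs preserves and reflects their
  disjointness, so it is an isomorphism of the packing games.\<close>

lemma nimber_state_eq:
  assumes G: "two_rows G r q m d e" and H: "two_rows H r' q' m d' e'"
    and bij: "bij_betw f {..<m} {..<m}"
    and arc_image: "\<And>i. i < m \<Longrightarrow> arc m d' (f i) = f ` arc m d i"
  shows "nimber (G, two_rows.state r q m d {}) = nimber (H, two_rows.state r' q' m d' {})"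
proof -
  interpret G: two_rows G r q m d e by (fact G)
  interpret H: two_rows H r' q' m d' e' by (fact H)
  have disj_iff: "arc m d' (f i) \<inter> arc m d' (f j) = {} \<longleftrightarrow> arc m d i \<inter> arc m d j = {}"
    if "i < m" "j < m" for i j
    using inj_on_image_Int[OF bij_betw_imp_inj_on[OF bij] arc_subset arc_subset, OF that, of d d]
    by (metis arc_image image_is_empty that)
  have inj: "inj_on f {..<m}" and onto: "f ` {..<m} = {..<m}"
    using bij by (auto simp: bij_betw_def)
  have packing_image: "packing m d' (f ` S) \<longleftrightarrow> packing m d S" if "S \<subseteq> {..<m}" for S
  proof -
    have "(f i \<noteq> f j \<longrightarrow> arc m d' (f i) \<inter> arc m d' (f j) = {}) \<longleftrightarrow>
        (i \<noteq> j \<longrightarrow> arc m d i \<inter> arc m d j = {})" if "i \<in> S" "j \<in> S" for i j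
      using that \<open>S \<subseteq> {..<m}\<close> disj_iff[of i j] inj_on_eq_iff[OF inj, of i j] by blast
    moreover have "f ` S \<subseteq> {..<m}"
      using image_mono[OF \<open>S \<subseteq> {..<m}\<close>, of f] onto by simp
    ultimately show ?thesis
      unfolding packing_def using that by simp
  qed
  let ?R = "\<lambda>X Y. \<exists>S. packing m d S \<and> X = G.state S \<and> Y = H.state (f ` S)"
  show ?thesis
  proof (rule nimber_bisim[OF G.simple H.simple, where R = ?R])
    show "?R (G.state {}) (H.state {})"
      using packing_empty by (intro exI[of _ "{}"]) simp
  next
    fix X Y X'
    assume "?R X Y" and mv: "legal_move G X X'"
    then obtain S where S: "packing m d S" "X = G.state S" "Y = H.state (f ` S)"
      by blast
    obtain i where i: "i \<notin> S" "packing m d (insert i S)" "X' = G.state (insert i S)"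
      using mv unfolding S(2) G.legal_move_state_iff[OF S(1)] by blast
    have sub: "S \<subseteq> {..<m}" "insert i S \<subseteq> {..<m}" using i(2) by (auto simp: packing_def)
    have "packing m d' (f ` S)" "packing m d' (insert (f i) (f ` S))"
      using packing_image[OF sub(1)] packing_image[OF sub(2)] S i by auto
    moreover have "f i \<notin> f ` S"
      using i(1) sub inj by (auto simp: inj_on_def)
    ultimately have "legal_move H Y (H.state (f ` insert i S))"
      using S(3) H.legal_move_state_iff[OF \<open>packing m d' (f ` S)\<close>] by auto
    with i show "\<exists>Y'. legal_move H Y Y' \<and> ?R X' Y'" by blast
  next
    fix X Y Y'
    assume "?R X Y" and mv: "legal_move H Y Y'"
    then obtain S where S: "packing m d S" "X = G.state S" "Y = H.state (f ` S)"
      by blast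
    have sub: "S \<subseteq> {..<m}" using S(1) by (simp add: packing_def)
    have "packing m d' (f ` S)" using packing_image[OF sub] S by simp
    note H_moves = H.legal_move_state_iff[OF this]
    obtain j where j: "j \<notin> f ` S" "packing m d' (insert j (f ` S))"
      "Y' = H.state (insert j (f ` S))"
      using mv unfolding S(3) H_moves by blast
    then have "j \<in> f ` {..<m}" using onto by (simp add: packing_def)
    then obtain i where i: "i < m" "j = f i" by auto
    have "packing m d (insert i S)"
      using packing_image[of "insert i S"] i j sub by auto
    moreover have "i \<notin> S" using i j by auto
    ultimately have "legal_move G X (G.state (insert i S))"
      using S G.legal_move_state_iff[OF S(1)] by blast
    moreover have "Y' = H.state (f ` insert i S)" using i j by simp
    ultimately show "\<exists>X'. legal_move G X X' \<and> ?R X' Y'"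
      using \<open>packing m d (insert i S)\<close> by blast
  qed
qed

section \<open>Petersen graphs\<close>

text \<open>The edges of a row are listed from \<open>j\<close> to \<open>j + k\<close> only; this
  solves for the backward neighbor.\<close>

lemma mod_add_swap:
  fixes i j k m :: nat
  assumes "i < m" "j < m" "k \<le> m"
  shows "i = (j + k) mod m \<longleftrightarrow> j = (i + (m - k)) mod m"
proof -
  have "((x + y) mod m + z) mod m = x" if "x < m" "y + z = m" for x y z
    using that by (simp add: mod_simps add.assoc)
  from this[of j k "m - k"] this[of i "m - k" k] assms show ?thesis by auto
qed

lemma closed_nbhd_gen_petersen:
  assumes "i < m" "1 \<le> m" "k \<le> m"
  shows "closed_nbhd (gen_petersen m k) (1, i) = insert (0, i) ({1} \<times> arc m 1 i)"
    and "closed_nbhd (gen_petersen m k) (0, i) = insert (1, i) ({0} \<times> arc m k i)"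
proof -
  \<comment> \<open>\<open>j < m\<close> appears on the left because the edges are indexed by
    residues below \<open>m\<close>; on the right \<open>mod\<close> supplies it.\<close>
  have swap: "i = (j + l) mod m \<and> j < m \<longleftrightarrow> j = (i + (m - l)) mod m" if "l \<le> m" for j l
  proof -
    have "j = (i + (m - l)) mod m \<Longrightarrow> j < m"
      using assms(2) by simp
    then show ?thesis
      using mod_add_swap[OF \<open>i < m\<close> _ \<open>l \<le> m\<close>, of j] by blast
  qed
  have outer: "(r, j) \<in> closed_nbhd (gen_petersen m k) (1, i) \<longleftrightarrow>
      (r, j) = (1, i) \<or> (r, j) = (0, i) \<or>
      r = 1 \<and> (j = (i + 1) mod m \<or> i = (j + 1) mod m \<and> j < m)" for r j
    using \<open>i < m\<close> unfolding closed_nbhd_def gen_petersen_def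
    by (simp add: doubleton_eq_iff) blast
  show "closed_nbhd (gen_petersen m k) (1, i) = insert (0, i) ({1} \<times> arc m 1 i)"
    unfolding arc_def set_eq_iff split_paired_All outer swap[OF \<open>1 \<le> m\<close>] by blast
  have inner: "(r, j) \<in> closed_nbhd (gen_petersen m k) (0, i) \<longleftrightarrow>
      (r, j) = (0, i) \<or> (r, j) = (1, i) \<or>
      r = 0 \<and> (j = (i + k) mod m \<or> i = (j + k) mod m \<and> j < m)" for r j
    using \<open>i < m\<close> unfolding closed_nbhd_def gen_petersen_def
    by (simp add: doubleton_eq_iff) blast
  show "closed_nbhd (gen_petersen m k) (0, i) = insert (1, i) ({0} \<times> arc m k i)"
    unfolding arc_def set_eq_iff split_paired_All inner swap[OF \<open>k \<le> m\<close>] by blast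
qed

lemma two_rows_gen_petersen:
  assumes "m \<ge> 5" "k \<in> {1, 2}"
  shows "two_rows (gen_petersen m k) 1 0 m 1 k" "two_rows (gen_petersen m k) 0 1 m k 1"
proof -
  \<comment> \<open>\<open>k = 2\<close> is admissible because \<open>m \<ge> 5\<close> makes
    \<open>(m - 1) div 2\<close> at least 2.\<close>
  have km: "1 \<le> m" "k \<le> m" and "1 \<le> k" "k \<le> (m - 1) div 2"
    using assms by auto
  then have simple: "finite_simple_graph (gen_petersen m k)"
    by (intro finite_simple_graph_gen_petersen)
  have verts: "verts (gen_petersen m k) = {1, 0} \<times> {..<m}"
    "verts (gen_petersen m k) = {0, 1} \<times> {..<m}"
    by (auto simp: gen_petersen_def)
  have steps: "(1, k) \<in> {(1, 1), (1, 2), (2, 1)}" "(k, 1) \<in> {(1, 1), (1, 2), (2, 1)}"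
    using assms(2) by auto
  note nbhd = closed_nbhd_gen_petersen[OF _ km]
  show "two_rows (gen_petersen m k) 1 0 m 1 k"
    by (rule two_rows.intro[OF simple verts(1) _ nbhd assms(1) steps(1)]) simp
  show "two_rows (gen_petersen m k) 0 1 m k 1"
    by (rule two_rows.intro[OF simple verts(2) _ nbhd(2,1) assms(1) steps(2)]) simp
qed

lemma P01_eq_state:
  assumes "m \<ge> 5" "k \<in> {1, 2}"
  shows "P01 m k = (gen_petersen m k, two_rows.state 1 0 m 1 {})"
  unfolding P01_def two_rows.state_def[OF two_rows_gen_petersen(1)[OF assms]] by simp

lemma P10_eq_state:
  assumes "m \<ge> 5" "k \<in> {1, 2}"
  shows "P10 m k = (gen_petersen m k, two_rows.state 0 1 m k {})"
  unfolding P10_def two_rows.state_def[OF two_rows_gen_petersen(2)[OF assms]] by simp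

section \<open>Symmetries of the packing games\<close>

lemma bij_betw_double_mod:
  fixes m :: nat
  assumes "odd m"
  shows "bij_betw (\<lambda>i. 2 * i mod m) {..<m} {..<m}"
proof -
  obtain h where h: "m = 2 * h + 1"
    using assms by (elim oddE)
  \<comment> \<open>\<open>h + 1\<close> is the inverse of 2 modulo \<open>m\<close>, since
    \<open>2 * (h + 1) = m + 1\<close>.\<close>
  have "(h + 1) * (2 * x mod m) mod m = x" if "x < m" for x
  proof -
    have "(h + 1) * (2 * x) = x + x * m" by (simp add: h algebra_simps)
    then have "(h + 1) * (2 * x mod m) mod m = (x + x * m) mod m"
      by (metis mod_mult_right_eq)
    then show ?thesis using that by simp
  qed
  then have "inj_on (\<lambda>i. 2 * i mod m) {..<m}"
    by (intro inj_on_inverseI[of _ "\<lambda>y. (h + 1) * y mod m"]) simp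
  moreover have "(\<lambda>i. 2 * i mod m) ` {..<m} \<subseteq> {..<m}"
    using odd_pos[OF assms] by auto
  ultimately show ?thesis
    by (simp add: bij_betw_def endo_inj_surj)
qed

lemma arc_double:
  assumes "m \<ge> 2"
  shows "arc m 2 (2 * i mod m) = (\<lambda>i. 2 * i mod m) ` arc m 1 i"
proof -
  \<comment> \<open>Doubling \<open>m - 1\<close>, which stands for \<open>-1\<close>, gives
    \<open>m - 2\<close> plus one copy of \<open>m\<close>.\<close>
  have "2 * (i + (m - 1)) = 2 * i + (m - 2) + m" using assms by simp
  then have "2 * (i + (m - 1)) mod m = (2 * i + (m - 2)) mod m" by (simp only: mod_add_self2)
  then show ?thesis
    by (simp add: arc_def mod_simps algebra_simps)
qed

text \<open>Translations commute with forming arcs, and centres at distance \<open>h \<ge> 3\<close>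
  are too far apart for arcs of step 1 to meet.\<close>

lemma arc_antipode:
  assumes "h \<ge> 3" "m = 2 * h" "i < m"
  shows "((i + h) mod m + h) mod m = i"
    and "arc m 1 ((i + h) mod m) = (\<lambda>i. (i + h) mod m) ` arc m 1 i"
    and "arc m 1 i \<inter> arc m 1 ((i + h) mod m) = {}"
proof -
  show "((i + h) mod m + h) mod m = i"
    using assms by (simp add: mod_simps add.assoc flip: mult_2)
  show "arc m 1 ((i + h) mod m) = (\<lambda>i. (i + h) mod m) ` arc m 1 i"
    by (simp add: arc_def mod_simps ac_simps)
  show "arc m 1 i \<inter> arc m 1 ((i + h) mod m) = {}"
    using assms by (auto simp: arc_if add_mod_if split: if_splits)
qed

text \<open>For even \<open>m\<close>, step 2 preserves parity across the wraparound, and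
  \<open>\<phi>\<close> exchanges \<open>2 * j\<close> with \<open>2 * j + 1\<close>, so the two
  arcs lie in different classes. The antipodal map would fail here: for \<open>m = 8\<close> the
  arcs of \<open>i\<close> and \<open>i + 4\<close> share \<open>i + 2\<close>.\<close>

lemma arc_parity_swap:
  assumes "m \<ge> 5" "even m" "i < m"
  defines "\<phi> \<equiv> \<lambda>i::nat. if even i then i + 1 else i - 1"
  shows "arc m 2 (\<phi> i) = \<phi> ` arc m 2 i"
    and "arc m 2 i \<inter> arc m 2 (\<phi> i) = {}"
    and "\<phi> i < m"
proof -
  have mod_even: "even (x mod m) \<longleftrightarrow> even x" for x
    using \<open>even m\<close> by (rule dvd_mod_iff)
  have lt: "\<phi> x < m" if "x < m" for x
    using that \<open>even m\<close> unfolding \<phi>_def by (auto elim!: evenE oddE)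
  then show "\<phi> i < m" using \<open>i < m\<close> .
  \<comment> \<open>Wrapping around subtracts the even number \<open>m\<close>, so even translations
    commute with \<open>\<phi>\<close>.\<close>
  have shift: "\<phi> ((x + y) mod m) = (\<phi> x + y) mod m" if "even y" "x < m" "y < m" for x y
    unfolding add_mod_if[OF that(2) less_imp_le[OF that(3)]]
      add_mod_if[OF lt[OF that(2)] less_imp_le[OF that(3)]]
    using that \<open>even m\<close> unfolding \<phi>_def by (auto elim!: evenE oddE; presburger)
  show "arc m 2 (\<phi> i) = \<phi> ` arc m 2 i"
    unfolding arc_def image_insert image_empty
    using shift[of 2 i] shift[of "m - 2" i] assms(1-3) by simp
  have "even x \<longleftrightarrow> even j" if "x \<in> arc m 2 j" for x j
    using that \<open>m \<ge> 5\<close> \<open>even m\<close> by (auto simp: arc_def mod_even)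
  moreover have "even (\<phi> i) \<longleftrightarrow> odd i" by (simp add: \<phi>_def)
  ultimately show "arc m 2 i \<inter> arc m 2 (\<phi> i) = {}" by blast
qed

theorem theorem4p16:
  fixes m :: nat
  assumes "m \<ge> 5"
  shows "nimber (P01 m 1) = nimber (P10 m 1) \<and>
         nimber (P10 m 1) = nimber (P01 m 2) \<and>
         nimber (P01 m 2) = nimber (P10 m 2)"
proof -
  note rows = two_rows_gen_petersen[OF assms]
  note P = P01_eq_state[OF assms] P10_eq_state[OF assms]
  \<comment> \<open>The played row has step 1 in all three positions, so the identity carries arcs
    to arcs.\<close>
  have "nimber (P01 m 1) = nimber (P10 m 1)" "nimber (P10 m 1) = nimber (P01 m 2)"
    using nimber_state_eq[OF rows(1) rows(2), of 1 1 id]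
      nimber_state_eq[OF rows(2) rows(1), of 1 2 id] by (simp_all add: P)
  moreover have "nimber (P01 m 2) = nimber (P10 m 2)"
  proof (cases "even m")
    case True
    then obtain h where h: "m = 2 * h" by (elim evenE)
    \<comment> \<open>An even \<open>m \<ge> 5\<close> is at least 6, just enough for antipodal arcs
      to be disjoint.\<close>
    with assms have "h \<ge> 3" by simp
    have "nimber (P01 m 2) = 0"
      using two_rows.nimber_state_eq_0[OF rows(1), of 2 "\<lambda>i. (i + h) mod m"]
        arc_antipode[OF \<open>h \<ge> 3\<close> h] assms by (simp add: P)
    moreover have "nimber (P10 m 2) = 0"
      using two_rows.nimber_state_eq_0[OF rows(2), of 2 "\<lambda>i. if even i then i + 1 else i - 1"]
        arc_parity_swap[OF assms True] by (simp add: P)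
    ultimately show ?thesis by simp
  next
    case False
    \<comment> \<open>Doubling turns step 1 of the outer row into step 2 of the inner row.\<close>
    show ?thesis
      using nimber_state_eq[OF rows(1) rows(2) bij_betw_double_mod[OF False], of 2 2]
        arc_double assms by (simp add: P)
  qed
  ultimately show ?thesis by simp
qed

end
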